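(* Let $(X,d)$ be a compact metric space and let $f_{0,\infty}=\{f_n\}_{n=0}^{\infty}$ be an equi-continuous sequence of continuous maps $f_n:X\to X$. If $h(f_{0,\infty})>0$, then $h(\tilde f_{0,\infty})=h(\bar f_{0,\infty})=+\infty$, where $\bar f_{0,\infty}$ is the induced sequence on $(\mathcal K(X),D_X)$ and $\tilde f_{0,\infty}$ is the induced sequence on $(\mathcal F(X),d_E)$.
   Context: Non-autonomous systems: for a sequence $f_{0,\infty}=\{f_n\}_{n\ge 0}$ of continuous self-maps of a compact metric space $(X,d)$, $f_0^0=\mathrm{id}$ and $f_0^n=f_{n-1}\circ\cdots\circ f_0$ for $n\ge1$. Topological entropy: for $n\ge1$, $\epsilon>0$, a set $E\subset X$ is $(n,\epsilon)$-separated if for all $x\ne y$ in $E$ there is $0\le k\le n-1$ with $d(f_0^k(x),f_0^k(y))>\epsilon$. For $\Lambda\subset X$ let $s_n(\epsilon,\Lambda,f_{0,\infty})$ be the maximal cardinality of an $(n,\epsilon)$-separated subset of $\Lambda$; put $h(f_{0,\infty},\Lambda)=\lim_{\epsilon\to0}\limsup_{n\to\infty}\frac1n\log s_n(\epsilon,\Lambda,f_{0,\infty})$ and $h(f_{0,\infty})=h(f_{0,\infty},X)\in[0,+\infty]$. Hyperspace: $\mathcal K(X)$ is the set of nonempty compact subsets of $X$ with the Hausdorff metric $D_X$; $\bar f_{0,\infty}=\{\bar f_n\}_{n\ge0}$ with $\bar f_n(A)=f_n(A)$. Fuzzy sets: $I=[0,1]$; $\mathcal F(X)$ is the set of all upper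 semicontinuous $u:X\to I$; $\tilde f_{0,\infty}=\{\tilde f_n\}_{n\ge0}$, where $\tilde f_n(u)(x)=\sup_{z\in f_n^{-1}(x)}u(z)$ if $f_n^{-1}(x)\neq\emptyset$ and $\tilde f_n(u)(x)=0$ otherwise. The endograph of $u$ is $end(u)=\{(x,a)\in X\times I:u(x)\ge a\}$. With $X\times I$ carrying the max product metric and $D_{X\times I}$ the Hausdorff metric on $\mathcal K(X\times I)$, the endograph metric is $d_E(u,v)=D_{X\times I}(end(u),end(v))$ for $u,v$ not identically zero; for the empty fuzzy set $\emptyset_X\equiv0$, $d_E(\emptyset_X,\emptyset_X)=0$ and $d_E(\emptyset_X,u)$ is the Hausdorff distance between the parts of $end(\emptyset_X)$ and $end(u)$ lying in $\mathrm{supp}(u)\times I$, where $\mathrm{supp}(u)=\overline{\{x:u(x)>0\}}$. $(\mathcal F(X),d_E)$ is a compact metric space. Entropies of the induced systems: $h(\bar f_{0,\infty})=\lim_{\epsilon\to0}\limsup_{n\to\infty}\frac1n\log s_n(\epsilon,\mathcal K(X),\bar f_{0,\infty})$, where $s_n(\epsilon,\mathcal K(X),\bar f_{0,\infty})$ is the maximal cardinality of a set $E\subset\mathcal K(X)$ such that for all $A\ne B$ in $E$ there is $0\le k\le n-1$ with $D_X(\bar f_0^k(A),\bar f_0^k(B))>\epsilon$; and $h(\tilde f_{0,\infty})=\lim_{\epsilon\to0}\limsup_{n\to\infty}\frac1n\log s_n(\epsilon,\mathcal F(X),\tilde f_{0,\infty})$, where $s_n(\epsilon,\mathcal F(X),\tilde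 f_{0,\infty})$ is the maximal cardinality of a set $E\subset\mathcal F(X)$ such that for all $u\ne v$ in $E$ there is $0\le k\le n-1$ with $d_E(\tilde f_0^k(u),\tilde f_0^k(v))>\epsilon$. Here $\bar f_0^0$ and $\tilde f_0^0$ are identity maps, $\bar f_0^k=\bar f_{k-1}\circ\cdots\circ\bar f_0$ and $\tilde f_0^k=\tilde f_{k-1}\circ\cdots\circ\tilde f_0$ for $k\ge1$. *)

theory Defs
  imports "HOL-Analysis.Analysis"
begin

section \<open>Non-autonomous systems and their topological entropy\<close>

text \<open>The phase spaces carry different metrics (the given one, the Hausdorff metric, the endograph
  metric), so the metric \<open>d\<close> and the phase space, resp.\ the subset \<open>\<Lambda>\<close> of it, are explicit
  parameters.\<close>

primrec nds_iter :: "(nat \<Rightarrow> 'x \<Rightarrow> 'x) \<Rightarrow> nat \<Rightarrow> 'x \<Rightarrow> 'x" where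
  "nds_iter f 0 = id"
| "nds_iter f (Suc n) = f n \<circ> nds_iter f n"

definition separated ::
  "('x \<Rightarrow> 'x \<Rightarrow> real) \<Rightarrow> (nat \<Rightarrow> 'x \<Rightarrow> 'x) \<Rightarrow> nat \<Rightarrow> real \<Rightarrow> 'x set \<Rightarrow> bool" where
  "separated d f n \<epsilon> E \<longleftrightarrow>
     (\<forall>x\<in>E. \<forall>y\<in>E. x \<noteq> y \<longrightarrow> (\<exists>k<n. d (nds_iter f k x) (nds_iter f k y) > \<epsilon>))"

text \<open>A supremum over the finite separated sets: it is the maximal cardinality whenever that is
  finite, and \<open>\<infinity>\<close> if there are arbitrarily large separated sets, since subsets of separated sets
  are separated.\<close>

definition sep_number ::
  "('x \<Rightarrow> 'x \<Rightarrow> real) \<Rightarrow> (nat \<Rightarrow> 'x \<Rightarrow> 'x) \<Rightarrow> nat \<Rightarrow> real \<Rightarrow> 'x set \<Rightarrow> enat" where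
  "sep_number d f n \<epsilon> \<Lambda> = Sup {enat (card E) | E. finite E \<and> E \<subseteq> \<Lambda> \<and> separated d f n \<epsilon> E}"

definition log_enat :: "enat \<Rightarrow> ereal" where
  "log_enat m =
     (case m of enat k \<Rightarrow> if k = 0 then - \<infinity> else ereal (ln (real k)) | \<infinity> \<Rightarrow> \<infinity>)"

definition sep_growth ::
  "('x \<Rightarrow> 'x \<Rightarrow> real) \<Rightarrow> (nat \<Rightarrow> 'x \<Rightarrow> 'x) \<Rightarrow> 'x set \<Rightarrow> real \<Rightarrow> ereal" where
  "sep_growth d f \<Lambda> \<epsilon> = limsup (\<lambda>n. log_enat (sep_number d f n \<epsilon> \<Lambda>) / ereal (real n))"

definition entropy ::
  "('x \<Rightarrow> 'x \<Rightarrow> real) \<Rightarrow> (nat \<Rightarrow> 'x \<Rightarrow> 'x) \<Rightarrow> 'x set \<Rightarrow> ereal" where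
  "entropy d f \<Lambda> = Lim (at_right 0) (sep_growth d f \<Lambda>)"

definition equicontinuous_seq :: "(nat \<Rightarrow> 'a::metric_space \<Rightarrow> 'a) \<Rightarrow> bool" where
  "equicontinuous_seq f \<longleftrightarrow>
     (\<forall>\<epsilon>>0. \<exists>\<delta>>0. \<forall>n x y. dist x y < \<delta> \<longrightarrow> dist (f n x) (f n y) < \<epsilon>)"


section \<open>The hyperspace of compact sets\<close>

definition hausdorff_dist :: "('x \<Rightarrow> 'x \<Rightarrow> real) \<Rightarrow> 'x set \<Rightarrow> 'x set \<Rightarrow> real" where
  "hausdorff_dist d A B = max (SUP a\<in>A. INF b\<in>B. d a b) (SUP b\<in>B. INF a\<in>A. d a b)"

definition hyperspace :: "'a::metric_space set set" where
  "hyperspace = {A. compact A \<and> A \<noteq> {}}"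

definition induced_hyper :: "(nat \<Rightarrow> 'a \<Rightarrow> 'a) \<Rightarrow> nat \<Rightarrow> 'a set \<Rightarrow> 'a set" where
  "induced_hyper f n A = f n ` A"


section \<open>Fuzzy sets with the endograph metric\<close>

definition fuzzy_sets :: "('a::metric_space \<Rightarrow> real) set" where
  "fuzzy_sets = {u. (\<forall>x. 0 \<le> u x \<and> u x \<le> 1) \<and> (\<forall>a. closed {x. a \<le> u x})}"

definition induced_fuzzy ::
  "(nat \<Rightarrow> 'a \<Rightarrow> 'a) \<Rightarrow> nat \<Rightarrow> ('a \<Rightarrow> real) \<Rightarrow> 'a \<Rightarrow> real" where
  "induced_fuzzy f n u x = (if f n -` {x} \<noteq> {} then (SUP z\<in>f n -` {x}. u z) else 0)"

text \<open>The library metric on the product type is the Euclidean one, so it is not used here.\<close>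

definition max_dist :: "'a::metric_space \<times> real \<Rightarrow> 'a \<times> real \<Rightarrow> real" where
  "max_dist p q = max (dist (fst p) (fst q)) (dist (snd p) (snd q))"

definition endograph :: "('a \<Rightarrow> real) \<Rightarrow> ('a \<times> real) set" where
  "endograph u = {(x, a). 0 \<le> a \<and> a \<le> 1 \<and> a \<le> u x}"

definition empty_fuzzy :: "'a \<Rightarrow> real" where
  "empty_fuzzy = (\<lambda>x. 0)"

definition fuzzy_supp :: "('a::metric_space \<Rightarrow> real) \<Rightarrow> 'a set" where
  "fuzzy_supp u = closure {x. u x > 0}"

definition dist_to_empty :: "('a::metric_space \<Rightarrow> real) \<Rightarrow> real" where
  "dist_to_empty u =
     hausdorff_dist max_dist (endograph empty_fuzzy \<inter> fuzzy_supp u \<times> {0..1})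
       (endograph u \<inter> fuzzy_supp u \<times> {0..1})"

definition endograph_dist :: "('a::metric_space \<Rightarrow> real) \<Rightarrow> ('a \<Rightarrow> real) \<Rightarrow> real" where
  "endograph_dist u v =
     (if u = empty_fuzzy \<and> v = empty_fuzzy then 0
      else if u = empty_fuzzy then dist_to_empty v
      else if v = empty_fuzzy then dist_to_empty u
      else hausdorff_dist max_dist (endograph u) (endograph v))"

end

theory Submission
  imports Defs
begin

text \<open>Let \<open>E\<close> be an \<open>(n, \<epsilon>)\<close>-separated set of size at least \<open>exp (c n)\<close> and consider the family of
  its \<open>k\<close>-element subsets. Fix a block length \<open>m\<close>. By equicontinuity there is \<open>\<delta>\<close> such that orbits
  that are \<open>\<delta>\<close>-close at some time remain \<open>\<epsilon>/2\<close>-close for the next \<open>m\<close> steps. If \<open>B\<close> stays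
  \<open>\<delta>\<close>-close to \<open>A\<close> in the Hausdorff metric, then each \<open>b \<in> B\<close> is determined by recording, at the
  multiples of \<open>m\<close> below \<open>n\<close>, one point of \<open>A\<close> whose orbit is \<open>\<delta>\<close>-close to that of \<open>b\<close>. So at most
  about \<open>k^(k n / m)\<close> sets \<open>B\<close> are close to a given \<open>A\<close>, and a maximal \<open>(n, \<delta>)\<close>-separated subfamily has
  size about \<open>exp (k (c - ln k / m) n)\<close>. Taking first \<open>k\<close> and then \<open>m\<close> large makes the exponent
  arbitrarily large. The indicator functions of the sets in such a family are separated in the endograph
  metric.\<close>

section \<open>Separated sets and topological entropy\<close>

lemma log_enat_mono: "a \<le> b \<Longrightarrow> log_enat a \<le> log_enat b"
  by (cases a; cases b) (auto simp: log_enat_def)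

lemma sep_growth_antimono:
  assumes "\<epsilon> \<le> \<epsilon>'"
  shows "sep_growth d f \<Lambda> \<epsilon>' \<le> sep_growth d f \<Lambda> \<epsilon>"
proof -
  have sep: "separated d f n \<epsilon> E" if "separated d f n \<epsilon>' E" for n E
    unfolding separated_def
  proof (intro ballI impI)
    fix x y assume "x \<in> E" "y \<in> E" "x \<noteq> y"
    then obtain k where "k < n" "\<epsilon>' < d (nds_iter f k x) (nds_iter f k y)"
      using \<open>separated d f n \<epsilon>' E\<close> unfolding separated_def by blast
    then show "\<exists>k<n. \<epsilon> < d (nds_iter f k x) (nds_iter f k y)"
      using assms by (intro exI[of _ k]) auto
  qed
  have "sep_number d f n \<epsilon>' \<Lambda> \<le> sep_number d f n \<epsilon> \<Lambda>" for n
    unfolding sep_number_def using sep by (intro Sup_subset_mono) blast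
  then show ?thesis
    unfolding sep_growth_def
    by (intro Limsup_mono eventually_mono[OF eventually_gt_at_top[of 0]] ereal_divide_right_mono
        log_enat_mono) auto
qed

text \<open>Shrinking \<epsilon> only increases the growth rate, so the limit at 0 from the right
  exists and is a supremum; bounds on the entropy can then be checked at one scale at a
  time.\<close>

lemma entropy_eq_SUP: "entropy d f \<Lambda> = (SUP \<epsilon>\<in>{0<..}. sep_growth d f \<Lambda> \<epsilon>)" (is "_ = ?S")
proof -
  have "(sep_growth d f \<Lambda> \<longlongrightarrow> ?S) (at_right 0)"
  proof (rule increasing_tendsto)
    show "\<forall>\<^sub>F \<epsilon> in at_right 0. sep_growth d f \<Lambda> \<epsilon> \<le> ?S"
      using eventually_at_right_less[of "0::real"] by eventually_elim (auto intro: SUP_upper)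
  next
    fix x assume "x < ?S"
    then obtain e where e: "e > 0" "x < sep_growth d f \<Lambda> e" by (auto simp: less_SUP_iff)
    then show "\<forall>\<^sub>F \<epsilon> in at_right 0. x < sep_growth d f \<Lambda> \<epsilon>"
      unfolding eventually_at_right_field
      by (intro exI[of _ e]) (metis less_le_trans less_imp_le sep_growth_antimono)
  qed
  then show ?thesis
    unfolding entropy_def by (intro tendsto_Lim) auto
qed

text \<open>A positive supremum is witnessed at one scale, with a real rate \<open>c\<close>
  strictly below the growth there. A limsup controls only infinitely many \<open>n\<close>, hence
  the frequent quantifier.\<close>

lemma exponential_separated_of_entropy_pos:
  assumes "0 < entropy d f \<Lambda>"
  obtains \<epsilon> c where "\<epsilon> > 0" "c > 0"
    "\<exists>\<^sub>F n in sequentially.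
      \<exists>E\<subseteq>\<Lambda>. finite E \<and> separated d f n \<epsilon> E \<and> exp (c * real n) \<le> real (card E)"
proof -
  obtain \<epsilon> where \<epsilon>: "\<epsilon> > 0" "0 < sep_growth d f \<Lambda> \<epsilon>"
    using assms by (auto simp: entropy_eq_SUP less_SUP_iff)
  obtain c where c: "0 < ereal c" "ereal c < sep_growth d f \<Lambda> \<epsilon>"
    using ereal_dense2[OF \<epsilon>(2)] by auto
  let ?l = "\<lambda>n. log_enat (sep_number d f n \<epsilon> \<Lambda>) / ereal (real n)"
  have "\<exists>\<^sub>F n in sequentially. ereal c < ?l n"
  proof (rule ccontr)
    assume "\<not> ?thesis"
    then have "\<forall>\<^sub>F n in sequentially. ?l n \<le> ereal c" by (simp add: not_frequently not_less)
    then have "sep_growth d f \<Lambda> \<epsilon> \<le> ereal c" unfolding sep_growth_def by (rule Limsup_bounded)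
    with c show False by simp
  qed
  then have "\<exists>\<^sub>F n in sequentially. ereal c < ?l n \<and> 0 < n"
    using eventually_gt_at_top by (rule frequently_eventually_frequently)
  then have "\<exists>\<^sub>F n in sequentially.
      \<exists>E\<subseteq>\<Lambda>. finite E \<and> separated d f n \<epsilon> E \<and> exp (c * real n) \<le> real (card E)"
  proof (rule frequently_elim1)
    fix n assume n: "ereal c < ?l n \<and> 0 < n"
    show "\<exists>E\<subseteq>\<Lambda>. finite E \<and> separated d f n \<epsilon> E \<and> exp (c * real n) \<le> real (card E)"
    proof (rule ccontr)
      assume neg: "\<not> ?thesis"
      \<comment> \<open>Without a large set, every separated set has at most the floor
        \<open>N\<close> of exp(c n) elements. As \<open>N\<close> is at least 1, its
        \<open>log_enat\<close> is an ordinary logarithm, at most c n.\<close>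
      define N where "N = nat \<lfloor>exp (c * real n)\<rfloor>"
      have "1 \<le> exp (c * real n)" using c by simp
      then have N: "1 \<le> N" "real N \<le> exp (c * real n)" unfolding N_def by linarith+
      have "sep_number d f n \<epsilon> \<Lambda> \<le> enat N"
        unfolding sep_number_def
      proof (rule Sup_least, clarify)
        fix E assume "finite E" "E \<subseteq> \<Lambda>" "separated d f n \<epsilon> E"
        then have "real (card E) < exp (c * real n)" using neg by (meson not_le)
        then show "enat (card E) \<le> enat N" unfolding N_def by simp linarith
      qed
      then have "log_enat (sep_number d f n \<epsilon> \<Lambda>) \<le> log_enat (enat N)" by (rule log_enat_mono)
      also have "\<dots> \<le> ereal (c * real n)"
        using N ln_le_cancel_iff[of "real N" "exp (c * real n)"] by (simp add: log_enat_def)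
      finally show False
        using n by (auto simp: ereal_less_divide_pos mult.commute)
    qed
  qed
  with \<epsilon> c that show thesis by simp
qed

text \<open>The converse criterion: the scale may depend on the rate \<open>K\<close>, because the
  entropy is a supremum over scales.\<close>

lemma entropy_infinite_of_exponential_separated:
  assumes "\<And>K. K > 0 \<Longrightarrow> \<exists>\<epsilon>>0. \<exists>\<^sub>F n in sequentially.
      \<exists>E\<subseteq>\<Lambda>. finite E \<and> separated d f n \<epsilon> E \<and> exp (K * real n) \<le> real (card E)"
  shows "entropy d f \<Lambda> = \<infinity>"
proof -
  have "ereal K \<le> entropy d f \<Lambda>" if pos: "K > 0" for K
  proof -
    obtain \<epsilon> where \<epsilon>: "\<epsilon> > 0" and fr: "\<exists>\<^sub>F n in sequentially.
        \<exists>E\<subseteq>\<Lambda>. finite E \<and> separated d f n \<epsilon> E \<and> exp (K * real n) \<le> real (card E)"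
      using assms[OF pos] by auto
    let ?l = "\<lambda>n. log_enat (sep_number d f n \<epsilon> \<Lambda>) / ereal (real n)"
    from fr have "\<exists>\<^sub>F n in sequentially. (\<exists>E\<subseteq>\<Lambda>. finite E \<and> separated d f n \<epsilon> E \<and>
        exp (K * real n) \<le> real (card E)) \<and> 0 < n"
      using eventually_gt_at_top by (rule frequently_eventually_frequently)
    then have fr': "\<exists>\<^sub>F n in sequentially. ereal K \<le> ?l n"
    proof (rule frequently_elim1, elim conjE exE)
      fix n :: nat and E
      assume n: "0 < n" and E: "E \<subseteq> \<Lambda>" "finite E" "separated d f n \<epsilon> E"
        "exp (K * real n) \<le> real (card E)"
      have card: "0 < real (card E)" using E(4) exp_gt_zero[of "K * real n"] by linarith
      have "enat (card E) \<le> sep_number d f n \<epsilon> \<Lambda>"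
        unfolding sep_number_def using E by (intro Sup_upper) blast
      then have "log_enat (enat (card E)) \<le> log_enat (sep_number d f n \<epsilon> \<Lambda>)"
        by (rule log_enat_mono)
      moreover have "ereal (K * real n) \<le> log_enat (enat (card E))"
        using card E(4) by (simp add: log_enat_def ln_ge_iff)
      ultimately show "ereal K \<le> ?l n"
        using n by (simp add: ereal_le_divide_pos mult.commute)
    qed
    have "ereal K \<le> sep_growth d f \<Lambda> \<epsilon>"
    proof (rule ccontr)
      assume "\<not> ?thesis"
      then have "\<forall>\<^sub>F n in sequentially. ?l n < ereal K"
        unfolding sep_growth_def by (intro Limsup_lessD) simp
      with fr' show False by (simp add: frequently_def not_le)
    qed
    also have "\<dots> \<le> entropy d f \<Lambda>"
      unfolding entropy_eq_SUP using \<epsilon> by (intro SUP_upper) auto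
    finally show ?thesis .
  qed
  \<comment> \<open>Only positive rates are covered so far, so an arbitrary real \<open>B\<close> is
    first raised to a positive one.\<close>
  then have "ereal (max B 1) \<le> entropy d f \<Lambda>" for B by (meson less_max_iff_disj zero_less_one)
  moreover have "ereal B \<le> ereal (max B 1)" for B by simp
  ultimately have "ereal B \<le> entropy d f \<Lambda>" for B by (rule order_trans[rotated])
  then show ?thesis by (rule ereal_top)
qed

text \<open>A separated subset of maximal cardinality meets every ball of radius \<open>\<epsilon>\<close> in the Bowen metric.\<close>

lemma large_separated_subset:
  assumes "finite C"
    and sym: "\<And>x y. d x y = d y x"
    and refl: "\<And>x k. x \<in> C \<Longrightarrow> d (nds_iter f k x) (nds_iter f k x) \<le> \<epsilon>"
    and balls: "\<And>x. x \<in> C \<Longrightarrow>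
      card {y\<in>C. \<forall>k<n. d (nds_iter f k x) (nds_iter f k y) \<le> \<epsilon>} \<le> N"
  obtains S where "S \<subseteq> C" "separated d f n \<epsilon> S" "card C \<le> card S * N"
proof -
  define P where "P S \<longleftrightarrow> S \<subseteq> C \<and> separated d f n \<epsilon> S" for S
  have "P {}" by (simp add: P_def separated_def)
  moreover have "\<forall>S. P S \<longrightarrow> card S \<le> card C"
    using \<open>finite C\<close> by (auto simp: P_def card_mono)
  ultimately obtain S where S: "P S" and max: "\<And>T. P T \<Longrightarrow> card T \<le> card S"
    using ex_has_greatest_nat[of P "{}" card "Suc (card C)"]
    by (auto simp: less_Suc_eq_le)
  let ?ball = "\<lambda>x. {y\<in>C. \<forall>k<n. d (nds_iter f k x) (nds_iter f k y) \<le> \<epsilon>}"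
  have SC: "S \<subseteq> C" using S P_def by auto
  then have finS: "finite S" using \<open>finite C\<close> finite_subset by blast
  have "C \<subseteq> (\<Union>x\<in>S. ?ball x)"
  proof
    fix y assume y: "y \<in> C"
    show "y \<in> (\<Union>x\<in>S. ?ball x)"
    proof (cases "y \<in> S")
      case True
      then show ?thesis using y refl by auto
    next
      case False
      \<comment> \<open>By maximality some pair in \<open>insert y S\<close> stays close. It cannot
        lie inside the separated set \<open>S\<close>, so one member is \<open>y\<close> and, by
        symmetry, the other is the centre of a ball containing \<open>y\<close>.\<close>
      then have "\<not> P (insert y S)" using max[of "insert y S"] finS by auto
      then have "\<not> separated d f n \<epsilon> (insert y S)" using y SC by (auto simp: P_def)
      then obtain u v where uv: "u \<in> insert y S" "v \<in> insert y S" "u \<noteq> v"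
        "\<forall>k<n. d (nds_iter f k u) (nds_iter f k v) \<le> \<epsilon>"
        unfolding separated_def not_less[symmetric] by blast
      moreover have "\<not> (u \<in> S \<and> v \<in> S)"
        using S uv by (force simp: P_def separated_def)
      moreover have "\<forall>k<n. d (nds_iter f k v) (nds_iter f k u) \<le> \<epsilon>"
        using uv(4) by (subst sym)
      ultimately show ?thesis using y by auto
    qed
  qed
  then have "card C \<le> card (\<Union>x\<in>S. ?ball x)"
    using finS \<open>finite C\<close> by (intro card_mono) auto
  also have "\<dots> \<le> (\<Sum>x\<in>S. card (?ball x))" using finS by (rule card_UN_le)
  also have "\<dots> \<le> card S * N"
    using sum_bounded_above[of S "\<lambda>x. card (?ball x)" N] balls SC by auto
  finally show thesis using S that by (auto simp: P_def)
qed

section \<open>Equicontinuity and separated families of finite sets in the hyperspace\<close>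

text \<open>Induction on the block length: the radius for \<open>m\<close> steps is pulled back
  through one more map, uniformly in its index, and the minimum with \<epsilon> covers
  \<open>r = 0\<close>.\<close>

lemma equicontinuous_iterates:
  assumes "equicontinuous_seq f" "\<epsilon> > 0"
  shows "\<exists>\<delta>>0. \<forall>n x y. dist (nds_iter f n x) (nds_iter f n y) < \<delta> \<longrightarrow>
    (\<forall>r\<le>m. dist (nds_iter f (n + r) x) (nds_iter f (n + r) y) < \<epsilon>)"
proof (induction m)
  case 0
  then show ?case using \<open>\<epsilon> > 0\<close> by auto
next
  case (Suc m)
  obtain \<delta> where \<delta>: "\<delta> > 0" "\<And>n x y r. dist (nds_iter f n x) (nds_iter f n y) < \<delta> \<Longrightarrow> r \<le> m \<Longrightarrow>
      dist (nds_iter f (n + r) x) (nds_iter f (n + r) y) < \<epsilon>"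
    using Suc by auto
  obtain \<theta> where \<theta>: "\<theta> > 0" "\<And>n x y. dist x y < \<theta> \<Longrightarrow> dist (f n x) (f n y) < \<delta>"
    using assms \<delta>(1) unfolding equicontinuous_seq_def by metis
  have "dist (nds_iter f (n + r) x) (nds_iter f (n + r) y) < \<epsilon>"
    if *: "dist (nds_iter f n x) (nds_iter f n y) < min \<epsilon> \<theta>" and r: "r \<le> Suc m" for n x y r
  proof (cases r)
    case 0
    then show ?thesis using * by simp
  next
    case (Suc r')
    have "dist (nds_iter f (Suc n) x) (nds_iter f (Suc n) y) < \<delta>"
      using \<theta>(2) * by simp
    from \<delta>(2)[OF this, of r'] show ?thesis using Suc r by simp
  qed
  then show ?case
    using \<open>\<epsilon> > 0\<close> \<theta>(1) by (intro exI[of _ "min \<epsilon> \<theta>"]) auto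
qed

lemma hausdorff_dist_sym:
  assumes "\<And>x y. d x y = d y x"
  shows "hausdorff_dist d A B = hausdorff_dist d B A"
  using assms by (simp add: hausdorff_dist_def max.commute)

lemma hausdorff_dist_refl_finite:
  assumes "finite A" "A \<noteq> {}"
  shows "hausdorff_dist dist A A = 0"
proof -
  have "(INF b\<in>A. dist a b) = 0" if "a \<in> A" for a
    using that assms by (intro cInf_eq_minimum) (auto intro: image_eqI[of _ _ a])
  moreover have "(INF a\<in>A. dist a b) = 0" if "b \<in> A" for b
    using that assms by (intro cInf_eq_minimum) (auto intro: image_eqI[of _ _ b])
  ultimately show ?thesis
    using assms by (simp add: hausdorff_dist_def)
qed

text \<open>Over a finite set the infimum is attained, so the same non-strict bound \<delta> holds
  for an actual point.\<close>

lemma hausdorff_dist_le_finiteD: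
  assumes "finite A" "A \<noteq> {}" "finite B" "hausdorff_dist d A B \<le> \<delta>" "b \<in> B"
  obtains a where "a \<in> A" "d a b \<le> \<delta>"
proof -
  have "(INF a\<in>A. d a b) \<le> (SUP b\<in>B. INF a\<in>A. d a b)"
    using assms by (intro cSUP_upper bdd_above_finite finite_imageI)
  also have "\<dots> \<le> \<delta>" using assms by (simp add: hausdorff_dist_def)
  finally have "Min ((\<lambda>a. d a b) ` A) \<le> \<delta>"
    using assms by (simp add: cInf_eq_Min)
  then show thesis using that assms by (auto simp: Min_le_iff)
qed

lemma nds_iter_induced_hyper: "nds_iter (induced_hyper f) k A = nds_iter f k ` A"
  by (induction k) (simp_all add: induced_hyper_def image_comp)

text \<open>The inner power bounds the points of \<open>E\<close> that \<open>A\<close> shadows at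
  every block start; the outer power bounds the \<open>k\<close>-element sets of such
  points.\<close>

lemma card_hausdorff_close_sets_le:
  fixes f :: "nat \<Rightarrow> 'a::metric_space \<Rightarrow> 'a"
  assumes E: "finite E" "separated dist f n \<epsilon> E"
    and near: "\<And>i x y r. dist (nds_iter f i x) (nds_iter f i y) \<le> \<delta> \<Longrightarrow> r < m \<Longrightarrow>
      dist (nds_iter f (i + r) x) (nds_iter f (i + r) y) < \<epsilon> / 2"
    and "m > 0" "k > 0"
    and A: "finite A" "card A = k"
  shows "card {B \<in> {B. B \<subseteq> E \<and> card B = k}.
      \<forall>i<n. hausdorff_dist dist (nds_iter f i ` A) (nds_iter f i ` B) \<le> \<delta>}
    \<le> (k ^ Suc (n div m)) ^ k" (is "card ?\<B> \<le> _")
proof -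
  define J where "J = {j. j * m < n}"
  have "J \<subseteq> {..n div m}"
    using \<open>m > 0\<close> by (auto simp: J_def less_eq_div_iff_mult_less_eq)
  then have J: "finite J" "card J \<le> Suc (n div m)"
    using finite_subset card_mono[of "{..n div m}" J] by auto
  define shadows where
    "shadows b j a \<longleftrightarrow> a \<in> A \<and> dist (nds_iter f (j * m) a) (nds_iter f (j * m) b) \<le> \<delta>" for b j a
  define R where "R = {b\<in>E. \<forall>j\<in>J. \<exists>a. shadows b j a}"
  \<comment> \<open>Restriction to \<open>J\<close> makes the codes extensional, so they lie in a
    function space of \<open>k ^ card J\<close> elements.\<close>
  define code where "code b = (\<lambda>j\<in>J. SOME a. shadows b j a)" for b
  have code: "shadows b j (code b j)" if "b \<in> R" "j \<in> J" for b j
    using that someI_ex[of "shadows b j"] by (auto simp: R_def code_def)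
  have "code \<in> R \<rightarrow> (J \<rightarrow>\<^sub>E A)"
    using code by (auto simp: shadows_def) (auto simp: code_def)
  moreover have "inj_on code R"
  proof (rule inj_onI, rule ccontr)
    fix b b' assume R: "b \<in> R" "b' \<in> R" and eq: "code b = code b'" and "b \<noteq> b'"
    then obtain i where i: "i < n" "\<epsilon> < dist (nds_iter f i b) (nds_iter f i b')"
      using E(2) unfolding separated_def R_def by blast
    \<comment> \<open>At the start of the block containing time \<open>i\<close>, equal codes give
      one common shadow; it is still within \<epsilon>/2 of both points at time
      \<open>i\<close>.\<close>
    define j where "j = i div m"
    have "j * m \<le> i" by (simp add: j_def)
    then have "j \<in> J" using i(1) by (simp add: J_def)
    have ij: "i = j * m + i mod m" by (simp add: j_def)
    have "dist (nds_iter f i (code b j)) (nds_iter f i b) < \<epsilon> / 2"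
      using near[of "j * m" "code b j" b "i mod m"] code[OF R(1) \<open>j \<in> J\<close>] \<open>m > 0\<close> ij
      by (auto simp: shadows_def)
    moreover have "dist (nds_iter f i (code b j)) (nds_iter f i b') < \<epsilon> / 2"
      using near[of "j * m" "code b j" b' "i mod m"] code[OF R(2) \<open>j \<in> J\<close>] \<open>m > 0\<close> ij eq
      by (auto simp: shadows_def)
    ultimately show False
      using i(2) dist_triangle3[of "nds_iter f i b" "nds_iter f i b'" "nds_iter f i (code b j)"]
      by linarith
  qed
  ultimately have "card R \<le> card (J \<rightarrow>\<^sub>E A)"
    using J A by (intro card_inj_on_le finite_PiE) auto
  also have "\<dots> = k ^ card J" using J A by (simp add: card_PiE)
  also have "\<dots> \<le> k ^ Suc (n div m)" using J \<open>k > 0\<close> by (intro power_increasing) auto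
  finally have cardR: "card R \<le> k ^ Suc (n div m)" .
  have finR: "finite R" using E by (simp add: R_def)
  have "?\<B> \<subseteq> {B. B \<subseteq> R \<and> card B = k}"
  proof clarify
    fix B assume B: "B \<subseteq> E" "k = card B"
      "\<forall>i<n. hausdorff_dist dist (nds_iter f i ` A) (nds_iter f i ` B) \<le> \<delta>"
    have "b \<in> R" if b: "b \<in> B" for b
    proof -
      have "\<exists>a. shadows b j a" if "j \<in> J" for j
      proof -
        have "j * m < n" using that by (simp add: J_def)
        then have "hausdorff_dist dist (nds_iter f (j * m) ` A) (nds_iter f (j * m) ` B) \<le> \<delta>"
          using B(3) by blast
        moreover have "A \<noteq> {}" "finite B" using A \<open>k > 0\<close> B(1) E(1) finite_subset by auto
        ultimately obtain a' where "a' \<in> nds_iter f (j * m) ` A"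
          "dist a' (nds_iter f (j * m) b) \<le> \<delta>"
          using A(1) b hausdorff_dist_le_finiteD[of "nds_iter f (j * m) ` A"
              "nds_iter f (j * m) ` B" dist \<delta> "nds_iter f (j * m) b"] by blast
        then show ?thesis by (auto simp: shadows_def)
      qed
      then show ?thesis using b B by (auto simp: R_def)
    qed
    then show "B \<subseteq> R \<and> card B = card B" by auto
  qed
  then have "card ?\<B> \<le> card {B. B \<subseteq> R \<and> card B = k}"
    using finR by (intro card_mono) auto
  also have "\<dots> = card R choose k" using finR by (rule n_subsets)
  also have "\<dots> \<le> card R ^ k"
    by (cases "k \<le> card R") (auto simp: binomial_le_pow binomial_eq_0)
  also have "\<dots> \<le> (k ^ Suc (n div m)) ^ k" using cardR by (intro power_mono) auto
  finally show ?thesis .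
qed

text \<open>The exponent \<open>c - ln k / m\<close> gained per point is at least \<open>3 c / 4\<close>, and the terms that do not
  grow with \<open>n\<close> cost at most another \<open>c / 4\<close>.\<close>

lemma exponential_separated_finite_sets:
  fixes f :: "nat \<Rightarrow> 'a::metric_space \<Rightarrow> 'a"
  assumes eq: "equicontinuous_seq f" and "0 < entropy dist f UNIV" and "K > 0"
  obtains \<delta> where "\<delta> > 0" "\<delta> < 1"
    "\<exists>\<^sub>F n in sequentially. \<exists>S\<subseteq>{A. finite A \<and> A \<noteq> {}}. finite S \<and>
      separated (hausdorff_dist dist) (induced_hyper f) n \<delta> S \<and> exp (K * real n) \<le> real (card S)"
proof -
  obtain \<epsilon> c where \<epsilon>: "\<epsilon> > 0" and c: "c > 0" and fr: "\<exists>\<^sub>F n in sequentially.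
      \<exists>E\<subseteq>UNIV. finite E \<and> separated dist f n \<epsilon> E \<and> exp (c * real n) \<le> real (card E)"
    using exponential_separated_of_entropy_pos[OF assms(2)] by blast
  \<comment> \<open>Half of the rate \<open>c\<close> per point will survive all losses, so
    \<open>k\<close> points must give k c / 2 \<ge> K.\<close>
  define k where "k = nat \<lceil>2 * K / c\<rceil>"
  have "0 < 2 * K / c" using \<open>K > 0\<close> c by simp
  then have "k > 0" "2 * K / c \<le> real k" unfolding k_def by linarith+
  then have k: "k > 0" "K \<le> real k * c / 2" using c by (simp_all add: field_simps)
  \<comment> \<open>Blocks this long make the coding cost ln k / m at most c / 4; \<open>Suc\<close>
    keeps \<open>m\<close> positive when \<open>k = 1\<close>.\<close>
  define m where "m = Suc (nat \<lceil>4 * ln k / c\<rceil>)"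
  have m: "m > 0" "ln k / m \<le> c / 4"
  proof -
    have "4 * ln k / c \<le> real m" unfolding m_def by linarith
    then show "ln k / m \<le> c / 4" using c by (simp add: field_simps m_def)
  qed (simp add: m_def)
  obtain \<delta>' where \<delta>': "\<delta>' > 0" "\<And>i x y r. dist (nds_iter f i x) (nds_iter f i y) < \<delta>' \<Longrightarrow> r \<le> m \<Longrightarrow>
      dist (nds_iter f (i + r) x) (nds_iter f (i + r) y) < \<epsilon> / 2"
    using equicontinuous_iterates[OF eq, of "\<epsilon> / 2" m] \<epsilon> by auto
  \<comment> \<open>Halving turns the non-strict bound by \<delta> into a strict one by
    \<open>\<delta>'\<close>. The cap below 1 is for the endograph metric, where heights differ by
    at most 1.\<close>
  define \<delta> where "\<delta> = min (\<delta>' / 2) (1 / 2)"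
  have \<delta>: "\<delta> > 0" "\<delta> < 1" "\<delta> < \<delta>'" using \<delta>'(1) by (auto simp: \<delta>_def)
  \<comment> \<open>The first threshold gives 2 ln k \<le> c n / 4, absorbing the constant terms;
    the second gives k \<le> c n, hence \<open>k \<le> card E\<close>.\<close>
  from fr have "\<exists>\<^sub>F n in sequentially.
      (\<exists>E\<subseteq>UNIV. finite E \<and> separated dist f n \<epsilon> E \<and> exp (c * real n) \<le> real (card E)) \<and>
      max (8 * ln k / c) (k / c) \<le> real n"
    by (rule frequently_eventually_frequently)
      (rule filterlim_real_sequentially[unfolded filterlim_at_top, rule_format])
  then have "\<exists>\<^sub>F n in sequentially. \<exists>S\<subseteq>{A. finite A \<and> A \<noteq> {}}. finite S \<and>
      separated (hausdorff_dist dist) (induced_hyper f) n \<delta> S \<and> exp (K * real n) \<le> real (card S)"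
  proof (rule frequently_elim1, elim conjE exE)
    fix n :: nat and E :: "'a set"
    assume n: "max (8 * ln k / c) (k / c) \<le> real n"
      and E: "finite E" "separated dist f n \<epsilon> E" "exp (c * real n) \<le> real (card E)"
    define C where "C = {B. B \<subseteq> E \<and> card B = k}"
    define N where "N = (k ^ Suc (n div m)) ^ k"
    have C: "finite A \<and> A \<noteq> {}" if "A \<in> C" for A
      using that E(1) k(1) finite_subset by (auto simp: C_def)
    obtain S where S: "S \<subseteq> C" "separated (hausdorff_dist dist) (induced_hyper f) n \<delta> S"
      "card C \<le> card S * N"
    proof (rule large_separated_subset[of C "hausdorff_dist dist" "induced_hyper f" \<delta> n N])
      show "finite C" using E(1) by (simp add: C_def)
      show "hausdorff_dist dist A B = hausdorff_dist dist B A" for A B :: "'a set"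
        by (intro hausdorff_dist_sym dist_commute)
      show "hausdorff_dist dist (nds_iter (induced_hyper f) i A) (nds_iter (induced_hyper f) i A) \<le> \<delta>"
        if "A \<in> C" for A i
        using C[OF that] \<delta>(1) by (simp add: nds_iter_induced_hyper hausdorff_dist_refl_finite)
      show "card {B \<in> C. \<forall>i<n. hausdorff_dist dist (nds_iter (induced_hyper f) i A)
          (nds_iter (induced_hyper f) i B) \<le> \<delta>} \<le> N" if "A \<in> C" for A
        unfolding C_def N_def nds_iter_induced_hyper
      proof (rule card_hausdorff_close_sets_le[OF E(1,2) _ m(1) k(1)])
        show "finite A" "card A = k" using C[OF that] that by (auto simp: C_def)
        show "dist (nds_iter f (i + r) x) (nds_iter f (i + r) y) < \<epsilon> / 2"
          if "dist (nds_iter f i x) (nds_iter f i y) \<le> \<delta>" "r < m" for i x y r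
          using that \<delta>(3) by (intro \<delta>'(2)) auto
      qed
    qed
    have "k \<le> c * real n" using n c by (simp add: field_simps)
    also have "\<dots> \<le> exp (c * real n)" using exp_ge_add_one_self[of "c * real n"] by linarith
    also note E(3)
    finally have "k \<le> card E" by simp
    have expk: "real k = exp (ln k)" using k(1) by simp
    \<comment> \<open>The number of \<open>k\<close>-subsets is at least (card E / k)^k. With this
      bound and \<open>N\<close> both written as exponentials, dividing by \<open>N\<close> is a
      subtraction of exponents.\<close>
    have "exp (real k * (c * real n - ln k)) = (exp (c * real n) / real k) ^ k"
      using k(1) by (simp add: exp_of_nat_mult exp_diff)
    also have "\<dots> \<le> (real (card E) / real k) ^ k"
      using E(3) by (intro power_mono divide_right_mono) auto
    also have "\<dots> \<le> real (card E choose k)"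
      using \<open>k \<le> card E\<close> by (rule binomial_ge_n_over_k_pow_k)
    also have "\<dots> = real (card C)" using E(1) by (simp add: C_def n_subsets)
    also have "\<dots> \<le> real (card S) * real N"
      using S(3) by (metis of_nat_le_iff of_nat_mult)
    also have "real N = exp (real k * (real (Suc (n div m)) * ln k))"
      by (simp only: N_def of_nat_power exp_of_nat_mult) (use k(1) in simp)
    also have "real (card S) * \<dots> \<le> real (card S) * exp (real k * (c * real n / 4 + ln k))"
    proof -
      \<comment> \<open>The full blocks cost at most c n / 4; the extra one counted by
        \<open>Suc\<close> costs a single ln k.\<close>
      have "real (n div m) * ln k \<le> (real n / real m) * ln k"
        using k(1) of_nat_div_le_of_nat[where 'a = real] by (intro mult_right_mono) auto
      also have "\<dots> \<le> real n * (c / 4)"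
        using mult_left_mono[OF m(2), of "real n"] by simp
      finally have "real (Suc (n div m)) * ln k \<le> c * real n / 4 + ln k"
        by (simp add: algebra_simps)
      then show ?thesis by (intro mult_left_mono iffD2[OF exp_le_cancel_iff]) auto
    qed
    finally have "exp (real k * (c * real n - ln k) - real k * (c * real n / 4 + ln k)) \<le> card S"
      by (subst exp_diff) (simp add: divide_le_eq)
    moreover have "K * real n \<le> real k * (c * real n - ln k) - real k * (c * real n / 4 + ln k)"
    proof -
      have "K * real n \<le> real k * (c * real n / 2)"
        using mult_right_mono[OF k(2), of "real n"] by simp
      also have "\<dots> \<le> real k * (c * real n * 3 / 4 - 2 * ln k)"
        using n c by (intro mult_left_mono) (auto simp: field_simps)
      finally show ?thesis by (simp add: algebra_simps)
    qed
    ultimately have "exp (K * real n) \<le> card S" by (meson exp_le_cancel_iff order_trans)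
    moreover have "finite S" using S(1) E(1) finite_subset[of S C] by (simp add: C_def)
    ultimately show "\<exists>S\<subseteq>{A. finite A \<and> A \<noteq> {}}. finite S \<and>
      separated (hausdorff_dist dist) (induced_hyper f) n \<delta> S \<and> exp (K * real n) \<le> real (card S)"
      using S C by (intro exI[of _ S]) auto
  qed
  with \<delta>(1,2) show thesis by (rule that)
qed

section \<open>Fuzzy sets through indicator functions\<close>

lemma induced_fuzzy_indicator: "induced_fuzzy f n (indicator A) = indicator (f n ` A)"
proof
  fix x
  show "induced_fuzzy f n (indicator A) x = indicator (f n ` A) x"
  proof (cases "x \<in> f n ` A")
    case True
    then obtain z where z: "z \<in> A" "x = f n z" by auto
    then have "(SUP z\<in>f n -` {x}. indicator A z) = (1::real)"
      by (intro cSup_eq_maximum) (auto simp: indicator_def image_iff)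
    then show ?thesis using z by (auto simp: induced_fuzzy_def)
  next
    case False
    \<comment> \<open>The fibre misses \<open>A\<close>: if nonempty, its supremum is that of the
      constant 0; if empty, the default value is 0 as well.\<close>
    then have "(\<lambda>z. indicator A z :: real) ` (f n -` {x}) = (\<lambda>z. 0) ` (f n -` {x})"
      by (intro image_cong) (auto simp: indicator_def)
    then show ?thesis using False by (auto simp: induced_fuzzy_def)
  qed
qed

lemma nds_iter_induced_fuzzy_indicator:
  "nds_iter (induced_fuzzy f) k (indicator A) = indicator (nds_iter f k ` A)"
  by (induction k) (simp_all add: induced_fuzzy_indicator image_comp)

lemma indicator_in_fuzzy_sets:
  assumes "closed A"
  shows "indicator A \<in> fuzzy_sets"
proof -
  have "closed {x. a \<le> indicator A x}" for a :: real
  proof -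
    have "{x. a \<le> indicator A x} = (if a \<le> 0 then UNIV else if a \<le> 1 then A else {})"
      by (auto simp: indicator_def split: if_splits)
    then show ?thesis using assms by simp
  qed
  then show ?thesis by (simp add: fuzzy_sets_def)
qed

text \<open>A point \<open>a \<in> A\<close> at distance more than \<open>\<delta>\<close> from \<open>B\<close> gives the point \<open>(a, 1)\<close> of the endograph
  of the indicator of \<open>A\<close>, at height \<open>1 > \<delta>\<close> above the part of the other endograph outside \<open>B\<close>.\<close>

lemma endograph_excess_indicator:
  fixes A B :: "'a::metric_space set"
  assumes "bounded (UNIV :: 'a set)" "A \<noteq> {}" "B \<noteq> {}" "\<delta> < 1"
    and "\<delta> < (SUP a\<in>A. INF b\<in>B. dist a b)"
  shows "\<delta> < (SUP p\<in>endograph (indicator A). INF q\<in>endograph (indicator B). max_dist p q)"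
proof -
  \<comment> \<open>A diameter bound keeps the real suprema over \<open>A\<close> and over the
    endograph bounded above, as comparing with them requires.\<close>
  obtain D where D: "\<And>x y :: 'a. dist x y \<le> D"
    using assms(1) unfolding bounded_any_center by (metis UNIV_I bounded_two_points assms(1))
  have bdd: "bdd_below ((\<lambda>b. dist a b) ` B)" for a :: 'a
    by (rule bdd_belowI2[of _ 0]) simp
  obtain b0 where b0: "b0 \<in> B" using assms(3) by auto
  have "bdd_above ((\<lambda>a. INF b\<in>B. dist a b) ` A)"
    using b0 D by (intro bdd_aboveI2[of _ _ D]) (meson bdd cINF_lower order_trans)
  then obtain a where a: "a \<in> A" "\<delta> < (INF b\<in>B. dist a b)"
    using assms(2,5) by (auto simp: less_cSUP_iff)
  \<comment> \<open>From (a, 1), the other endograph is reached either above \<open>B\<close>, at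
    horizontal cost at least the distance to \<open>B\<close>, or at height 0, at vertical cost
    1.\<close>
  define \<eta> where "\<eta> = min (INF b\<in>B. dist a b) 1"
  have bdd': "bdd_below ((\<lambda>q. max_dist p q) ` endograph (indicator B))" for p :: "'a \<times> real"
    by (rule bdd_belowI2[of _ 0]) (simp add: max_dist_def le_max_iff_disj)
  have end0: "(b0, 0) \<in> endograph (indicator B)" by (simp add: endograph_def)
  have "\<delta> < \<eta>" using a assms(4) by (simp add: \<eta>_def)
  also have "\<eta> \<le> (INF q\<in>endograph (indicator B). max_dist (a, 1) q)"
  proof (rule cINF_greatest)
    show "endograph (indicator B) \<noteq> {}" using end0 by blast
    fix q :: "'a \<times> real" assume "q \<in> endograph (indicator B)"
    then consider "fst q \<in> B" | "snd q = 0"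
      by (cases "fst q \<in> B") (auto simp: endograph_def)
    then show "\<eta> \<le> max_dist (a, 1) q"
    proof cases
      case 1
      then have "(INF b\<in>B. dist a b) \<le> dist a (fst q)" by (intro cINF_lower bdd)
      then show ?thesis by (simp add: \<eta>_def max_dist_def)
    next
      case 2
      then show ?thesis by (simp add: \<eta>_def max_dist_def)
    qed
  qed
  also have "\<dots> \<le> (SUP p\<in>endograph (indicator A). INF q\<in>endograph (indicator B). max_dist p q)"
  proof (rule cSUP_upper)
    show "(a, 1) \<in> endograph (indicator A)" using a(1) by (simp add: endograph_def)
    show "bdd_above ((\<lambda>p. INF q\<in>endograph (indicator B). max_dist p q) ` endograph (indicator A))"
    proof (rule bdd_aboveI2)
      fix p :: "'a \<times> real" assume "p \<in> endograph (indicator A)"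
      then have "max_dist p (b0, 0) \<le> max D 1"
        using D[of "fst p" b0] by (auto simp: endograph_def max_dist_def le_max_iff_disj)
      then show "(INF q\<in>endograph (indicator B). max_dist p q) \<le> max D 1"
        using cINF_lower[OF bdd' end0, of p] by linarith
    qed
  qed
  finally show ?thesis .
qed

lemma max_dist_sym: "max_dist p q = max_dist q p"
  by (simp add: max_dist_def dist_commute)

text \<open>Nonempty sets have nonzero indicators, so \<open>endograph_dist\<close> is the plain
  Hausdorff distance here. Each one-sided excess transfers separately, the second with the roles of
  \<open>A\<close> and \<open>B\<close> exchanged.\<close>

lemma less_endograph_dist_indicator:
  fixes A B :: "'a::metric_space set"
  assumes "bounded (UNIV :: 'a set)" "A \<noteq> {}" "B \<noteq> {}" "\<delta> < 1" "\<delta> < hausdorff_dist dist A B"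
  shows "\<delta> < endograph_dist (indicator A) (indicator B)"
proof -
  have ne: "indicator S \<noteq> (empty_fuzzy :: 'a \<Rightarrow> real)" if "S \<noteq> {}" for S :: "'a set"
    using that by (auto simp: empty_fuzzy_def fun_eq_iff indicator_def)
  have "\<delta> < hausdorff_dist max_dist (endograph (indicator A)) (endograph (indicator B))"
    using assms(5) endograph_excess_indicator[OF assms(1,2,3,4)]
      endograph_excess_indicator[OF assms(1,3,2,4)]
    unfolding hausdorff_dist_def less_max_iff_disj
    by (auto simp: dist_commute max_dist_sym)
  then show ?thesis using assms(2,3) by (simp add: endograph_dist_def ne)
qed

section \<open>Transfer of the exponential growth to both induced systems\<close>

theorem theorem2p7:
  fixes f :: "nat \<Rightarrow> 'a::metric_space \<Rightarrow> 'a"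
  assumes "compact (UNIV :: 'a set)"
    and "\<And>n. continuous_on UNIV (f n)"
    and "equicontinuous_seq f"
    and "entropy dist f UNIV > 0"
  shows "entropy endograph_dist (induced_fuzzy f) fuzzy_sets = \<infinity>
    \<and> entropy (hausdorff_dist dist) (induced_hyper f) hyperspace = \<infinity>"
proof
  show "entropy endograph_dist (induced_fuzzy f) fuzzy_sets = \<infinity>"
  proof (rule entropy_infinite_of_exponential_separated)
    fix K :: real assume "K > 0"
    with assms(3,4) obtain \<delta> where \<delta>: "\<delta> > 0" "\<delta> < 1"
      and fr: "\<exists>\<^sub>F n in sequentially. \<exists>S\<subseteq>{A. finite A \<and> A \<noteq> {}}. finite S \<and>
        separated (hausdorff_dist dist) (induced_hyper f) n \<delta> S \<and> exp (K * real n) \<le> real (card S)"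
      by (rule exponential_separated_finite_sets)
    from fr have "\<exists>\<^sub>F n in sequentially. \<exists>E\<subseteq>fuzzy_sets. finite E \<and>
        separated endograph_dist (induced_fuzzy f) n \<delta> E \<and> exp (K * real n) \<le> real (card E)"
    proof (rule frequently_elim1, elim conjE exE)
      fix n :: nat and S :: "'a set set"
      assume S: "S \<subseteq> {A. finite A \<and> A \<noteq> {}}" "finite S"
        "separated (hausdorff_dist dist) (induced_hyper f) n \<delta> S" "exp (K * real n) \<le> real (card S)"
      \<comment> \<open>Indicators evolve as the indicators of the image sets, so a time that
        separates two sets separates their indicators at the same scale \<delta> < 1.\<close>
      have "separated endograph_dist (induced_fuzzy f) n \<delta> (indicator ` S)"
        unfolding separated_def
      proof (clarify)
        fix A B assume AB: "A \<in> S" "B \<in> S" "indicator A \<noteq> (indicator B :: 'a \<Rightarrow> real)"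
        then have "A \<noteq> B" by auto
        with AB(1,2) S(3)
        obtain i where "i < n" "\<delta> < hausdorff_dist dist (nds_iter f i ` A) (nds_iter f i ` B)"
          unfolding separated_def nds_iter_induced_hyper by meson
        then show "\<exists>i<n. \<delta> < endograph_dist (nds_iter (induced_fuzzy f) i (indicator A))
            (nds_iter (induced_fuzzy f) i (indicator B))"
          using AB S(1) \<delta>(2) compact_imp_bounded[OF assms(1)]
          unfolding nds_iter_induced_fuzzy_indicator
          by (intro exI[of _ i] conjI less_endograph_dist_indicator) auto
      qed
      moreover have "inj_on (indicator :: 'a set \<Rightarrow> 'a \<Rightarrow> real) S"
        by (auto simp: inj_on_def fun_eq_iff indicator_def split: if_splits)
      then have "card (indicator ` S :: ('a \<Rightarrow> real) set) = card S" by (rule card_image)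
      moreover have "indicator ` S \<subseteq> (fuzzy_sets :: ('a \<Rightarrow> real) set)"
        using S(1) by (auto intro: indicator_in_fuzzy_sets finite_imp_closed)
      ultimately show "\<exists>E\<subseteq>fuzzy_sets. finite E \<and>
          separated endograph_dist (induced_fuzzy f) n \<delta> E \<and> exp (K * real n) \<le> real (card E)"
        using S(2,4) by (intro exI[of _ "indicator ` S"]) auto
    qed
    with \<delta>(1) show "\<exists>\<epsilon>>0. \<exists>\<^sub>F n in sequentially. \<exists>E\<subseteq>fuzzy_sets. finite E \<and>
        separated endograph_dist (induced_fuzzy f) n \<epsilon> E \<and> exp (K * real n) \<le> real (card E)"
      by blast
  qed
  show "entropy (hausdorff_dist dist) (induced_hyper f) hyperspace = \<infinity>"
  proof (rule entropy_infinite_of_exponential_separated)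
    fix K :: real assume "K > 0"
    with assms(3,4) obtain \<delta> where "\<delta> > 0" and fr: "\<exists>\<^sub>F n in sequentially.
        \<exists>S\<subseteq>{A. finite A \<and> A \<noteq> {}}. finite S \<and>
        separated (hausdorff_dist dist) (induced_hyper f) n \<delta> S \<and> exp (K * real n) \<le> real (card S)"
      by (rule exponential_separated_finite_sets)
    \<comment> \<open>Finite nonempty sets are compact, so the families found above already live in
      the hyperspace.\<close>
    have "{A :: 'a set. finite A \<and> A \<noteq> {}} \<subseteq> hyperspace"
      by (auto simp: hyperspace_def finite_imp_compact)
    then have "\<exists>\<^sub>F n in sequentially. \<exists>S\<subseteq>hyperspace. finite S \<and>
        separated (hausdorff_dist dist) (induced_hyper f) n \<delta> S \<and> exp (K * real n) \<le> real (card S)"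
      using fr by (elim frequently_elim1) (meson order_trans)
    with \<open>\<delta> > 0\<close> show "\<exists>\<epsilon>>0. \<exists>\<^sub>F n in sequentially. \<exists>E\<subseteq>hyperspace. finite E \<and>
        separated (hausdorff_dist dist) (induced_hyper f) n \<epsilon> E \<and> exp (K * real n) \<le> real (card E)"
      by blast
  qed
qed

end
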